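(* Let $S=(\alpha_1,\dots,\alpha_n)$ be a list of positive integers, $M=\sum_{i=1}^n\alpha_i$, and let $X$ be the random variable on $\mathcal{X}=\{1,\dots,n\}$ with $\mathbb{P}[X=j]=\alpha_j/M$. Let $\mathcal{A}$ be a set with $|\mathcal{A}|=k$, and let $f:\mathcal{X}\to\mathcal{A}$ be an optimal $(n,k)$-partition function for $X$, i.e. $f$ maximizes the Shannon entropy $H(f(X))$ over all maps $\mathcal{X}\to\mathcal{A}$; write $A=f(X)$. Let $\mathcal{A}_1,\mathcal{A}_2$ be an arbitrary partition of $\mathcal{A}$ into two sets, and set $\mathcal{X}_i=f^{-1}(\mathcal{A}_i)$ for $i\in\{1,2\}$, where $\mathbb{P}[A\in\mathcal{A}_i]>0$ for $i=1,2$. Let $X_i$ be a random variable on $\mathcal{X}_i$ whose distribution is the conditional distribution of $X$ given $A\in\mathcal{A}_i$, and let $k_i=|\mathcal{A}_i|$, $n_i=|\mathcal{X}_i|$. Let $f_1:\mathcal{X}_1\to\mathcal{A}_1$ be any map maximizing $H(f_1(X_1))$ among all maps $\mathcal{X}_1\to\mathcal{A}_1$, and let $f_2:\mathcal{X}_2\to\mathcal{A}_2$ be any map maximizing $H(f_2(X_2))$ among all maps $\mathcal{X}_2\to\mathcal{A}_2$. Then the map $f_c:\mathcal{X}\to\mathcal{A}$ defined by $f_c(x)=f_1(x)$ for $x\in\mathcal{X}_1$ and $f_c(x)=f_2(x)$ for $x\in\mathcal{X}_2$ is an optimal $(n,k)$-partition function for $X$, i.e. it maximizes $H(f_c(X))$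 over all maps $\mathcal{X}\to\mathcal{A}$.
   Context: $H$ denotes Shannon entropy (base 2). An $(n,k)$-partition function for $X$ is any map $f:\mathcal{X}\to\mathcal{A}$ with $|\mathcal{X}|=n$, $|\mathcal{A}|=k$; it partitions $\mathcal{X}$ into the sets $f^{-1}(a)$, $a\in\mathcal{A}$, and the distribution of $f(X)$ is given by the subset sums divided by $M$. It is optimal if it maximizes $H(f(X))$. *)

theory Defs
  imports "HOL-Probability.Probability"
begin

text \<open>Base-2 Shannon entropy of a finite-range random variable: the library's \<open>\<H>(Y)\<close>
  of locale \<open>information_space\<close> with \<open>b = 2\<close>.\<close>

abbreviation shannon_entropy :: "'w measure \<Rightarrow> ('w \<Rightarrow> 'b) \<Rightarrow> real" where
  "shannon_entropy P Y \<equiv> prob_space.entropy P 2 (count_space (Y ` space P)) Y"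

definition partition_function :: "nat \<Rightarrow> nat \<Rightarrow> 'x set \<Rightarrow> 'a set \<Rightarrow> ('x \<Rightarrow> 'a) \<Rightarrow> bool" where
  "partition_function n k \<X> \<A> f \<longleftrightarrow>
     finite \<X> \<and> card \<X> = n \<and> finite \<A> \<and> card \<A> = k \<and> f \<in> \<X> \<rightarrow> \<A>"

text \<open>\<open>X\<close> is meant to take its values in \<open>\<X>\<close>, so the values of \<open>f\<close> outside \<open>\<X>\<close> are irrelevant.\<close>

definition optimal_partition_function ::
  "nat \<Rightarrow> nat \<Rightarrow> 'w measure \<Rightarrow> ('w \<Rightarrow> 'x) \<Rightarrow> 'x set \<Rightarrow> 'a set \<Rightarrow> ('x \<Rightarrow> 'a) \<Rightarrow> bool" where
  "optimal_partition_function n k P X \<X> \<A> f \<longleftrightarrow>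
     partition_function n k \<X> \<A> f \<and>
     (\<forall>g. partition_function n k \<X> \<A> g \<longrightarrow>
        shannon_entropy P (\<lambda>\<omega>. g (X \<omega>)) \<le> shannon_entropy P (\<lambda>\<omega>. f (X \<omega>)))"

end

theory Submission
  imports Defs
begin

text \<open>Grouping \<open>\<A>\<close> into \<open>\<A>\<^sub>1\<close> and \<open>\<A>\<^sub>2\<close>, the chain rule writes the entropy of any \<open>g(X)\<close> with
  \<open>g(\<X>\<^sub>i) \<subseteq> \<A>\<^sub>i\<close> as a constant plus the average of the entropies of \<open>g(X\<^sub>1)\<close> and \<open>g(X\<^sub>2)\<close>, weighted by the
  masses \<open>\<P>[A \<in> \<A>\<^sub>i]\<close>. Both \<open>f\<close> and \<open>f\<^sub>c\<close> are of this kind, and \<open>f\<^sub>c\<close> maximises each summand; hence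
  \<open>f\<^sub>c\<close> does at least as well as the optimal \<open>f\<close>.\<close>

definition block_mass :: "'x set \<Rightarrow> ('x \<Rightarrow> real) \<Rightarrow> ('x \<Rightarrow> 'a) \<Rightarrow> 'a \<Rightarrow> real" where
  "block_mass S p g b = (\<Sum>x\<in>{x\<in>S. g x = b}. p x)"

text \<open>The weights \<open>p\<close> are not required to sum to 1, so that this is additive over disjoint pieces.\<close>

definition block_entropy :: "'x set \<Rightarrow> 'a set \<Rightarrow> ('x \<Rightarrow> real) \<Rightarrow> ('x \<Rightarrow> 'a) \<Rightarrow> real" where
  "block_entropy S B p g = - (\<Sum>b\<in>B. block_mass S p g b * log 2 (block_mass S p g b))"

lemma block_mass_cong:
  assumes "\<And>x. x \<in> S \<Longrightarrow> p x = q x" "\<And>x. x \<in> S \<Longrightarrow> g x = h x"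
  shows "block_mass S p g b = block_mass S q h b"
  unfolding block_mass_def using assms by (intro sum.cong) auto

lemma block_entropy_cong:
  assumes "\<And>x. x \<in> S \<Longrightarrow> p x = q x" "\<And>x. x \<in> S \<Longrightarrow> g x = h x"
  shows "block_entropy S B p g = block_entropy S B q h"
  unfolding block_entropy_def using block_mass_cong[of S p q g h] assms by simp

text \<open>Since the targets are disjoint, no point of one domain can land in the target of the
  other. Each block therefore draws its whole mass from one side, and the sum over blocks splits
  with no correction term.\<close>

lemma block_entropy_Un:
  assumes "finite B\<^sub>1" "finite B\<^sub>2" "B\<^sub>1 \<inter> B\<^sub>2 = {}" "g \<in> S\<^sub>1 \<rightarrow> B\<^sub>1" "g \<in> S\<^sub>2 \<rightarrow> B\<^sub>2"
  shows "block_entropy (S\<^sub>1 \<union> S\<^sub>2) (B\<^sub>1 \<union> B\<^sub>2) p g = block_entropy S\<^sub>1 B\<^sub>1 p g + block_entropy S\<^sub>2 B\<^sub>2 p g"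
proof -
  have "block_mass (S\<^sub>1 \<union> S\<^sub>2) p g b = block_mass S\<^sub>1 p g b" if "b \<in> B\<^sub>1" for b
    unfolding block_mass_def using assms that by (intro sum.cong) auto
  moreover have "block_mass (S\<^sub>1 \<union> S\<^sub>2) p g b = block_mass S\<^sub>2 p g b" if "b \<in> B\<^sub>2" for b
    unfolding block_mass_def using assms that by (intro sum.cong) auto
  ultimately show ?thesis
    unfolding block_entropy_def by (simp add: sum.union_disjoint assms)
qed

lemma sum_block_mass:
  assumes "finite S" "finite B" "g \<in> S \<rightarrow> B"
  shows "(\<Sum>b\<in>B. block_mass S p g b) = (\<Sum>x\<in>S. p x)"
  unfolding block_mass_def using assms by (intro sum.group) auto

text \<open>This is the logarithm law \<open>log 2 (c * m) = log 2 c + log 2 m\<close> summed over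
  the blocks. The correction term involves only the total weight of \<open>S\<close>, not
  \<open>g\<close>, so rescaling the weights does not change which maps are maximal.\<close>

lemma block_entropy_scale:
  assumes "finite S" "finite B" "g \<in> S \<rightarrow> B" "\<And>x. x \<in> S \<Longrightarrow> 0 \<le> p x" "0 < c"
  shows "block_entropy S B (\<lambda>x. c * p x) g =
    c * block_entropy S B p g - c * log 2 c * (\<Sum>x\<in>S. p x)"
proof -
  define m where "m = block_mass S p g"
  have m_nonneg: "0 \<le> m b" for b
    unfolding m_def block_mass_def using assms by (intro sum_nonneg) auto
  have "block_mass S (\<lambda>x. c * p x) g b = c * m b" for b
    unfolding m_def block_mass_def by (simp add: sum_distrib_left)
  \<comment> \<open>The logarithm law needs a positive mass; for an empty or weightless block both
    sides vanish because of the factor \<open>m b\<close>.\<close>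
  moreover have "(c * m b) * log 2 (c * m b) = c * (m b * log 2 (m b)) + c * log 2 c * m b" for b
    using m_nonneg[of b] \<open>0 < c\<close> by (cases "m b = 0") (auto simp: log_mult algebra_simps)
  ultimately have "block_entropy S B (\<lambda>x. c * p x) g =
      - (c * (\<Sum>b\<in>B. m b * log 2 (m b)) + c * log 2 c * (\<Sum>b\<in>B. m b))"
    unfolding block_entropy_def by (simp add: sum.distrib sum_distrib_left)
  then show ?thesis
    using sum_block_mass[OF assms(1-3), of p] by (simp add: m_def block_entropy_def)
qed

text \<open>The event is a finite disjoint union of level sets of \<open>X\<close>, each measurable
  because singletons are measurable in a count space.\<close>

lemma (in prob_space) prob_eq_sum_values:
  assumes X: "X \<in> measurable M (count_space S)" and "finite S"
  shows "\<P>(\<omega> in M. Q (X \<omega>)) = (\<Sum>x\<in>{x\<in>S. Q x}. \<P>(\<omega> in M. X \<omega> = x))"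
proof -
  have val: "X \<omega> \<in> S" if "\<omega> \<in> space M" for \<omega>
    using measurable_space[OF X that] by simp
  have "{\<omega>\<in>space M. X \<omega> = x} \<in> events" if "x \<in> S" for x
  proof -
    have "X -` {x} \<inter> space M \<in> events"
      using that by (intro measurable_sets[OF X]) auto
    also have "X -` {x} \<inter> space M = {\<omega>\<in>space M. X \<omega> = x}" by auto
    finally show ?thesis .
  qed
  then have "prob (\<Union>x\<in>{x\<in>S. Q x}. {\<omega>\<in>space M. X \<omega> = x}) = (\<Sum>x\<in>{x\<in>S. Q x}. \<P>(\<omega> in M. X \<omega> = x))"
    using \<open>finite S\<close> by (intro finite_measure_finite_Union) (auto simp: disjoint_family_on_def)
  moreover have "(\<Union>x\<in>{x\<in>S. Q x}. {\<omega>\<in>space M. X \<omega> = x}) = {\<omega>\<in>space M. Q (X \<omega>)}"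
    using val by auto
  ultimately show ?thesis by simp
qed

text \<open>This turns the measure-theoretic entropy into a finite sum. The sum runs over the fixed
  target \<open>B\<close> instead of the range of \<open>g(X)\<close>, so that different maps are
  compared over the same index set.\<close>

lemma (in prob_space) shannon_entropy_eq_block_entropy:
  assumes X: "X \<in> measurable M (count_space S)" and "finite S" "finite B" "g \<in> S \<rightarrow> B"
  shows "shannon_entropy M (\<lambda>\<omega>. g (X \<omega>)) = block_entropy S B (\<lambda>x. \<P>(\<omega> in M. X \<omega> = x)) g"
proof -
  interpret information_space M 2 by unfold_locales simp
  let ?Y = "\<lambda>\<omega>. g (X \<omega>)"
  let ?m = "block_mass S (\<lambda>x. \<P>(\<omega> in M. X \<omega> = x)) g"
  have m: "?m b = \<P>(\<omega> in M. ?Y \<omega> = b)" for b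
    unfolding block_mass_def using prob_eq_sum_values[OF X \<open>finite S\<close>, of "\<lambda>x. g x = b"] by simp
  have Y_in: "?Y ` space M \<subseteq> B"
    using measurable_space[OF X] \<open>g \<in> S \<rightarrow> B\<close> by auto
  have "simple_function M X"
    unfolding simple_function_def
  proof (intro conjI ballI)
    show "finite (X ` space M)"
      using measurable_space[OF X] by (intro finite_subset[OF _ \<open>finite S\<close>]) auto
    show "X -` {x} \<inter> space M \<in> events" if "x \<in> X ` space M" for x
      using that measurable_space[OF X] by (intro measurable_sets[OF X]) auto
  qed
  then have "simple_function M ?Y"
    using simple_function_compose[of M X g] by (simp add: comp_def)
  then have "simple_distributed M ?Y ?m"
    by (rule simple_distributedI) (auto simp: m intro!: arg_cong[where f = prob])
  then have "shannon_entropy M ?Y = - (\<Sum>b\<in>?Y ` space M. ?m b * log 2 (?m b))"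
    by (rule entropy_simple_distributed)
  \<comment> \<open>A value of \<open>B\<close> that is not attained has the empty event as its
    level set, hence mass 0, and \<open>0 * log 2 0\<close> is 0 in HOL, in line with the usual
    convention for entropy.\<close>
  also have "(\<Sum>b\<in>?Y ` space M. ?m b * log 2 (?m b)) = (\<Sum>b\<in>B. ?m b * log 2 (?m b))"
  proof (rule sum.mono_neutral_left[OF \<open>finite B\<close> Y_in], rule ballI)
    fix b assume "b \<in> B - ?Y ` space M"
    then have "{\<omega>\<in>space M. ?Y \<omega> = b} = {}" by auto
    then show "?m b * log 2 (?m b) = 0" by (simp only: m) simp
  qed
  finally show ?thesis by (simp add: block_entropy_def)
qed

text \<open>On \<open>T\<close> the weights of \<open>X\<close> are those of \<open>Y\<close>
  multiplied by the probability \<open>c\<close> of the conditioning event. By the scaling law the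
  unnormalised block entropy is then an affine function of the entropy of \<open>g(Y)\<close>, with
  slope \<open>c > 0\<close> and an intercept independent of \<open>g\<close>; so a maximiser for
  \<open>Y\<close> also maximises the block entropy.\<close>

lemma (in prob_space) block_entropy_le_of_optimal_conditional:
  assumes X: "X \<in> measurable M (count_space S)" and "finite S" and "T = {x \<in> S. Q x}"
    and pos: "\<P>(\<omega> in M. Q (X \<omega>)) > 0"
    and "prob_space N" and Y: "Y \<in> measurable N (count_space T)"
    and distr: "\<forall>j\<in>T. \<P>(\<omega> in N. Y \<omega> = j) = \<P>(\<omega> in M. X \<omega> = j \<bar> Q (X \<omega>))"
    and opt: "optimal_partition_function n k N Y T B h"
    and g: "g \<in> T \<rightarrow> B"
  shows "block_entropy T B (\<lambda>x. \<P>(\<omega> in M. X \<omega> = x)) g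
    \<le> block_entropy T B (\<lambda>x. \<P>(\<omega> in M. X \<omega> = x)) h"
proof -
  interpret N: prob_space N by fact
  let ?p = "\<lambda>x. \<P>(\<omega> in M. X \<omega> = x)"
  let ?q = "\<lambda>x. \<P>(\<omega> in N. Y \<omega> = x)"
  define c where "c = \<P>(\<omega> in M. Q (X \<omega>))"
  have h: "h \<in> T \<rightarrow> B" and "finite T" "finite B"
    and le: "shannon_entropy N (\<lambda>\<omega>. g (Y \<omega>)) \<le> shannon_entropy N (\<lambda>\<omega>. h (Y \<omega>))"
    using opt g by (auto simp: optimal_partition_function_def partition_function_def)
  have "0 < c" using pos by (simp add: c_def)
  have pq: "?p x = c * ?q x" if "x \<in> T" for x
  proof -
    \<comment> \<open>For \<open>x\<close> in \<open>T\<close> the condition \<open>Q x\<close>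
      holds, so the joint event in the conditional probability is just \<open>X = x\<close>.\<close>
    have "{\<omega>\<in>space M. X \<omega> = x \<and> Q (X \<omega>)} = {\<omega>\<in>space M. X \<omega> = x}"
      using that \<open>T = _\<close> by auto
    then show ?thesis
      using that distr \<open>0 < c\<close> by (simp add: cond_prob_def c_def)
  qed
  have affine: "block_entropy T B ?p g' =
      c * shannon_entropy N (\<lambda>\<omega>. g' (Y \<omega>)) - c * log 2 c * (\<Sum>x\<in>T. ?q x)"
    if "g' \<in> T \<rightarrow> B" for g'
  proof -
    have "block_entropy T B ?p g' = block_entropy T B (\<lambda>x. c * ?q x) g'"
      by (rule block_entropy_cong) (auto simp: pq)
    then show ?thesis
      using block_entropy_scale[OF \<open>finite T\<close> \<open>finite B\<close> that, of ?q c] \<open>0 < c\<close>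
        N.shannon_entropy_eq_block_entropy[OF Y \<open>finite T\<close> \<open>finite B\<close> that]
      by simp
  qed
  show ?thesis
    unfolding affine[OF g] affine[OF h] using le \<open>0 < c\<close> by simp
qed

theorem theorem1:
  fixes \<alpha> :: "nat \<Rightarrow> nat" and n k M n\<^sub>1 n\<^sub>2 k\<^sub>1 k\<^sub>2 :: nat
    and P :: "'w measure" and P\<^sub>1 :: "'w1 measure" and P\<^sub>2 :: "'w2 measure"
    and X :: "'w \<Rightarrow> nat" and X\<^sub>1 :: "'w1 \<Rightarrow> nat" and X\<^sub>2 :: "'w2 \<Rightarrow> nat"
    and \<X> \<X>\<^sub>1 \<X>\<^sub>2 :: "nat set" and \<A> \<A>\<^sub>1 \<A>\<^sub>2 :: "'a set"
    and A :: "'w \<Rightarrow> 'a" and f f\<^sub>1 f\<^sub>2 f\<^sub>c :: "nat \<Rightarrow> 'a"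
  assumes \<alpha>_pos: "\<forall>i\<in>{1..n}. \<alpha> i > 0"
    and M: "M = (\<Sum>i=1..n. \<alpha> i)"
    and \<X>: "\<X> = {1..n}"
    and P: "prob_space P"
    and X: "X \<in> measurable P (count_space \<X>)"
    and distr_X: "\<forall>j\<in>\<X>. \<P>(\<omega> in P. X \<omega> = j) = real (\<alpha> j) / real M"
    and \<A>: "finite \<A>" "card \<A> = k"
    and f: "optimal_partition_function n k P X \<X> \<A> f"
    and A: "A = (\<lambda>\<omega>. f (X \<omega>))"
    and split_\<A>: "\<A>\<^sub>1 \<union> \<A>\<^sub>2 = \<A>" "\<A>\<^sub>1 \<inter> \<A>\<^sub>2 = {}"
    and \<X>\<^sub>1: "\<X>\<^sub>1 = {x \<in> \<X>. f x \<in> \<A>\<^sub>1}"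
    and \<X>\<^sub>2: "\<X>\<^sub>2 = {x \<in> \<X>. f x \<in> \<A>\<^sub>2}"
    and pos: "\<P>(\<omega> in P. A \<omega> \<in> \<A>\<^sub>1) > 0" "\<P>(\<omega> in P. A \<omega> \<in> \<A>\<^sub>2) > 0"
    and P\<^sub>1: "prob_space P\<^sub>1"
    and X\<^sub>1: "X\<^sub>1 \<in> measurable P\<^sub>1 (count_space \<X>\<^sub>1)"
    and distr_X\<^sub>1: "\<forall>j\<in>\<X>\<^sub>1. \<P>(\<omega> in P\<^sub>1. X\<^sub>1 \<omega> = j) = \<P>(\<omega> in P. X \<omega> = j \<bar> A \<omega> \<in> \<A>\<^sub>1)"
    and P\<^sub>2: "prob_space P\<^sub>2"
    and X\<^sub>2: "X\<^sub>2 \<in> measurable P\<^sub>2 (count_space \<X>\<^sub>2)"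
    and distr_X\<^sub>2: "\<forall>j\<in>\<X>\<^sub>2. \<P>(\<omega> in P\<^sub>2. X\<^sub>2 \<omega> = j) = \<P>(\<omega> in P. X \<omega> = j \<bar> A \<omega> \<in> \<A>\<^sub>2)"
    and cards: "k\<^sub>1 = card \<A>\<^sub>1" "k\<^sub>2 = card \<A>\<^sub>2" "n\<^sub>1 = card \<X>\<^sub>1" "n\<^sub>2 = card \<X>\<^sub>2"
    and f\<^sub>1: "optimal_partition_function n\<^sub>1 k\<^sub>1 P\<^sub>1 X\<^sub>1 \<X>\<^sub>1 \<A>\<^sub>1 f\<^sub>1"
    and f\<^sub>2: "optimal_partition_function n\<^sub>2 k\<^sub>2 P\<^sub>2 X\<^sub>2 \<X>\<^sub>2 \<A>\<^sub>2 f\<^sub>2"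
    and f\<^sub>c: "\<forall>x\<in>\<X>\<^sub>1. f\<^sub>c x = f\<^sub>1 x" "\<forall>x\<in>\<X>\<^sub>2. f\<^sub>c x = f\<^sub>2 x"
  shows "optimal_partition_function n k P X \<X> \<A> f\<^sub>c"
proof -
  interpret prob_space P by fact
  let ?p = "\<lambda>x. \<P>(\<omega> in P. X \<omega> = x)"
  let ?H = "\<lambda>g. shannon_entropy P (\<lambda>\<omega>. g (X \<omega>))"
  have "finite \<X>" using \<X> by simp
  have "finite \<A>\<^sub>1" "finite \<A>\<^sub>2" using \<A> split_\<A> by auto
  have f_in: "f \<in> \<X> \<rightarrow> \<A>" and "card \<X> = n"
    and f_max: "\<And>g. partition_function n k \<X> \<A> g \<Longrightarrow> ?H g \<le> ?H f"
    using f by (auto simp: optimal_partition_function_def partition_function_def)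
  have \<X>_Un: "\<X> = \<X>\<^sub>1 \<union> \<X>\<^sub>2" using f_in split_\<A> \<X>\<^sub>1 \<X>\<^sub>2 by auto
  have f_parts: "f \<in> \<X>\<^sub>1 \<rightarrow> \<A>\<^sub>1" "f \<in> \<X>\<^sub>2 \<rightarrow> \<A>\<^sub>2" using \<X>\<^sub>1 \<X>\<^sub>2 by auto
  have f\<^sub>c_parts: "f\<^sub>c \<in> \<X>\<^sub>1 \<rightarrow> \<A>\<^sub>1" "f\<^sub>c \<in> \<X>\<^sub>2 \<rightarrow> \<A>\<^sub>2"
    using f\<^sub>1 f\<^sub>2 f\<^sub>c by (auto simp: optimal_partition_function_def partition_function_def)
  \<comment> \<open>The decomposition is available only for maps that respect the split; a general
    competitor from \<open>\<X>\<close> to \<open>\<A>\<close> need not do so.\<close>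
  have split: "?H g = block_entropy \<X>\<^sub>1 \<A>\<^sub>1 ?p g + block_entropy \<X>\<^sub>2 \<A>\<^sub>2 ?p g"
    if g: "g \<in> \<X>\<^sub>1 \<rightarrow> \<A>\<^sub>1" "g \<in> \<X>\<^sub>2 \<rightarrow> \<A>\<^sub>2" for g
  proof -
    have "g \<in> \<X> \<rightarrow> \<A>" using g \<X>_Un split_\<A> by auto
    then have "?H g = block_entropy \<X> \<A> ?p g"
      by (rule shannon_entropy_eq_block_entropy[OF X \<open>finite \<X>\<close> \<A>(1)])
    also have "\<dots> = block_entropy \<X>\<^sub>1 \<A>\<^sub>1 ?p g + block_entropy \<X>\<^sub>2 \<A>\<^sub>2 ?p g"
      unfolding \<X>_Un split_\<A>(1)[symmetric]
      by (rule block_entropy_Un[OF \<open>finite \<A>\<^sub>1\<close> \<open>finite \<A>\<^sub>2\<close> split_\<A>(2) g])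
    finally show ?thesis .
  qed
  \<comment> \<open>Here the conditioning predicate is \<open>f x \<in> \<A>\<^sub>1\<close>, which
    at \<open>X\<close> is the event that \<open>A\<close> lies in \<open>\<A>\<^sub>1\<close>; the
    restriction of \<open>f\<close> is one of the competitors of \<open>f\<^sub>1\<close>.\<close>
  have "block_entropy \<X>\<^sub>1 \<A>\<^sub>1 ?p f \<le> block_entropy \<X>\<^sub>1 \<A>\<^sub>1 ?p f\<^sub>1"
    using block_entropy_le_of_optimal_conditional[OF X \<open>finite \<X>\<close> \<X>\<^sub>1 _ P\<^sub>1 X\<^sub>1 _ f\<^sub>1 f_parts(1)]
      pos(1) distr_X\<^sub>1 by (simp add: A)
  also have "\<dots> = block_entropy \<X>\<^sub>1 \<A>\<^sub>1 ?p f\<^sub>c"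
    using f\<^sub>c(1) by (intro block_entropy_cong) auto
  finally have le1: "block_entropy \<X>\<^sub>1 \<A>\<^sub>1 ?p f \<le> block_entropy \<X>\<^sub>1 \<A>\<^sub>1 ?p f\<^sub>c" .
  have "block_entropy \<X>\<^sub>2 \<A>\<^sub>2 ?p f \<le> block_entropy \<X>\<^sub>2 \<A>\<^sub>2 ?p f\<^sub>2"
    using block_entropy_le_of_optimal_conditional[OF X \<open>finite \<X>\<close> \<X>\<^sub>2 _ P\<^sub>2 X\<^sub>2 _ f\<^sub>2 f_parts(2)]
      pos(2) distr_X\<^sub>2 by (simp add: A)
  also have "\<dots> = block_entropy \<X>\<^sub>2 \<A>\<^sub>2 ?p f\<^sub>c"
    using f\<^sub>c(2) by (intro block_entropy_cong) auto
  finally have "block_entropy \<X>\<^sub>2 \<A>\<^sub>2 ?p f \<le> block_entropy \<X>\<^sub>2 \<A>\<^sub>2 ?p f\<^sub>c" .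
  with le1 have "?H f \<le> ?H f\<^sub>c"
    unfolding split[OF f_parts] split[OF f\<^sub>c_parts] by linarith
  moreover have "partition_function n k \<X> \<A> f\<^sub>c"
    using f\<^sub>c_parts \<X>_Un split_\<A> \<A> \<open>finite \<X>\<close> \<open>card \<X> = n\<close>
    by (auto simp: partition_function_def)
  \<comment> \<open>A competitor that mixes the two sides is never compared with
    \<open>f\<^sub>c\<close> directly: the optimality of \<open>f\<close> bounds its entropy by that
    of \<open>f\<close>, which is at most that of \<open>f\<^sub>c\<close>.\<close>
  ultimately show ?thesis
    using f_max order_trans unfolding optimal_partition_function_def by blast
qed

end
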